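(* Let $P$ be a two-dimensional poset of width $w$ with realizers $L_1, L_2$. Then there is a queue layout of the cover graph of $P$ in at most $w(w+1)/2$ queues whose vertex order is either $L_1$ or $L_2$.
   Context: A poset $P=(X,<)$ is a finite set with a transitive, asymmetric relation; its width is the maximum number of pairwise incomparable elements. A cover relation $a\prec b$ means $a<b$ with no $c$ satisfying $a<c<b$; the cover graph of $P$ has vertex set $X$ and an edge $\{a,b\}$ for each cover relation. A linear extension is a total order $L$ of $X$ with $a<_L b$ whenever $a<_P b$. $P$ is two-dimensional with realizers $L_1,L_2$ if $L_1,L_2$ are linear extensions such that $a<b$ in $P$ iff $a<b$ in both $L_1$ and $L_2$ (and $P$ is not a chain-free-of-dimension-1 case is not required). Given a vertex order $\sigma$, two edges $(u,v),(a,b)$ nest if $u<_\sigma a<_\sigma b<_\sigma v$; a $k$-queue layout with order $\sigma$ is a partition of the edges into $k$ sets (queues) none of which contains two nesting edges. *)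

theory Defs
  imports Main "HOL-Library.Disjoint_Sets"
begin

text \<open>All orders are strict and are given as relations contained in \<open>X \<times> X\<close>.\<close>

definition finite_poset :: "'a set \<Rightarrow> 'a rel \<Rightarrow> bool" where
  "finite_poset X r \<longleftrightarrow> finite X \<and> r \<subseteq> X \<times> X \<and> trans r \<and> asym r"

definition antichain_in :: "'a set \<Rightarrow> 'a rel \<Rightarrow> 'a set \<Rightarrow> bool" where
  "antichain_in X r A \<longleftrightarrow> A \<subseteq> X \<and> (\<forall>a\<in>A. \<forall>b\<in>A. (a, b) \<notin> r \<and> (b, a) \<notin> r)"

definition width :: "'a set \<Rightarrow> 'a rel \<Rightarrow> nat" where
  "width X r = Max (card ` {A. antichain_in X r A})"

definition covers :: "'a rel \<Rightarrow> 'a \<Rightarrow> 'a \<Rightarrow> bool" where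
  "covers r a b \<longleftrightarrow> (a, b) \<in> r \<and> (\<nexists>c. (a, c) \<in> r \<and> (c, b) \<in> r)"

text \<open>The cover graph has vertex set \<open>X\<close>; its edges are unordered pairs.\<close>

definition cover_graph_edges :: "'a rel \<Rightarrow> 'a set set" where
  "cover_graph_edges r = {{a, b} | a b. covers r a b}"

definition total_order_of :: "'a set \<Rightarrow> 'a rel \<Rightarrow> bool" where
  "total_order_of X L \<longleftrightarrow> L \<subseteq> X \<times> X \<and> strict_linear_order_on X L"

definition linear_extension :: "'a set \<Rightarrow> 'a rel \<Rightarrow> 'a rel \<Rightarrow> bool" where
  "linear_extension X r L \<longleftrightarrow> total_order_of X L \<and> (\<forall>a b. (a, b) \<in> r \<longrightarrow> (a, b) \<in> L)"

text \<open>Posets of dimension 1 (chains) are not excluded: \<open>L1 = L2\<close> is allowed.\<close>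

definition two_dimensional_realizers :: "'a set \<Rightarrow> 'a rel \<Rightarrow> 'a rel \<Rightarrow> 'a rel \<Rightarrow> bool" where
  "two_dimensional_realizers X r L1 L2 \<longleftrightarrow>
     linear_extension X r L1 \<and> linear_extension X r L2 \<and>
     (\<forall>a\<in>X. \<forall>b\<in>X. (a, b) \<in> r \<longleftrightarrow> (a, b) \<in> L1 \<and> (a, b) \<in> L2)"

text \<open>\<open>nests \<sigma> e f\<close>: edge \<open>f\<close> lies strictly inside edge \<open>e\<close>, with no shared endpoint.\<close>

definition nests :: "'a rel \<Rightarrow> 'a set \<Rightarrow> 'a set \<Rightarrow> bool" where
  "nests \<sigma> e f \<longleftrightarrow>
     (\<exists>u v a b. e = {u, v} \<and> f = {a, b} \<and> (u, a) \<in> \<sigma> \<and> (a, b) \<in> \<sigma> \<and> (b, v) \<in> \<sigma>)"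

text \<open>\<open>Q\<close> is the set of queues. As \<open>partition_on\<close> demands nonempty blocks, only bounds of the
  form ``at most \<open>k\<close> queues'' on \<open>card Q\<close> are meaningful.\<close>

definition queue_layout ::
  "'a set \<Rightarrow> 'a set set \<Rightarrow> 'a rel \<Rightarrow> 'a set set set \<Rightarrow> bool" where
  "queue_layout V E \<sigma> Q \<longleftrightarrow>
     total_order_of V \<sigma> \<and> finite Q \<and> partition_on E Q \<and>
     (\<forall>q\<in>Q. \<forall>e\<in>q. \<forall>f\<in>q. \<not> nests \<sigma> e f)"

end

theory Submission
  imports Defs
begin

text \<open>
  Take \<open>\<sigma> = L1\<close> and assign to a cover relation \<open>a \<prec> b\<close> the pair \<open>(s, t)\<close>, where \<open>t\<close> is the
  width of \<open>{z. z \<le> a\<close> in \<open>L1\<close> and \<open>a \<le> z\<close> in \<open>L2}\<close>, and \<open>s\<close> is the width of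
  \<open>{z. b \<le> z\<close> in \<open>L1\<close> and \<open>z < a\<close> in \<open>L2}\<close>. Every element of the second set is incomparable
  to every element of the first, so \<open>s + t \<le> w\<close>; with \<open>t \<ge> 1\<close> this leaves \<open>w (w + 1) / 2\<close> pairs.
  Suppose that \<open>u < a < b < v\<close> in \<open>L1\<close>, where \<open>u \<prec> v\<close> and \<open>a \<prec> b\<close>. If \<open>a < u\<close> in \<open>L2\<close>, then
  adding \<open>a\<close> to an antichain counted by \<open>t\<close> for \<open>(u, v)\<close> gives one for \<open>(a, b)\<close>. Otherwise
  \<open>u < a\<close> in the poset; as \<open>v\<close> covers \<open>u\<close>, \<open>a < v\<close> fails in the poset and hence \<open>v < a\<close> in \<open>L2\<close>,
  and \<open>v\<close> extends the antichains counted by \<open>s\<close>. In either case the two pairs differ.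
\<close>

section \<open>Strict total orders\<close>

lemma total_order_of_trans:
  "total_order_of X L \<Longrightarrow> (a, b) \<in> L \<Longrightarrow> (b, c) \<in> L \<Longrightarrow> (a, c) \<in> L"
  unfolding total_order_of_def strict_linear_order_on_def by (meson transD)

lemma total_order_of_irrefl: "total_order_of X L \<Longrightarrow> (a, a) \<notin> L"
  unfolding total_order_of_def strict_linear_order_on_def irrefl_def by blast

lemma total_order_of_asym: "total_order_of X L \<Longrightarrow> (a, b) \<in> L \<Longrightarrow> (b, a) \<notin> L"
  using total_order_of_trans total_order_of_irrefl by metis

lemma total_order_of_total:
  "total_order_of X L \<Longrightarrow> a \<in> X \<Longrightarrow> b \<in> X \<Longrightarrow> a \<noteq> b \<Longrightarrow> (a, b) \<in> L \<or> (b, a) \<in> L"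
  unfolding total_order_of_def strict_linear_order_on_def total_on_def by blast

lemma total_order_of_subset: "total_order_of X L \<Longrightarrow> (a, b) \<in> L \<Longrightarrow> a \<in> X \<and> b \<in> X"
  unfolding total_order_of_def by blast

section \<open>Antichains and width\<close>

lemma finite_antichains: "finite X \<Longrightarrow> finite {A. antichain_in X r A}"
  by (rule finite_subset[of _ "Pow X"]) (auto simp: antichain_in_def)

lemma card_le_width:
  assumes "finite X" "antichain_in X r A"
  shows "card A \<le> width X r"
  unfolding width_def using assms finite_antichains by (intro Max_ge) auto

lemma width_witness:
  assumes "finite X"
  obtains A where "antichain_in X r A" "card A = width X r"
proof -
  \<comment> \<open>The empty antichain makes the maximum range over a nonempty set, even when
    \<open>X\<close> is empty.\<close>
  have "antichain_in X r {}"
    by (simp add: antichain_in_def)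
  then have "width X r \<in> card ` {A. antichain_in X r A}"
    unfolding width_def using finite_antichains[OF assms] by (intro Max_in) auto
  then show thesis
    using that by auto
qed

text \<open>Maximum antichains of \<open>X\<close> and of \<open>Y\<close> are disjoint, and their
  union is again an antichain.\<close>

lemma width_add_le:
  assumes "finite Z" "X \<union> Y \<subseteq> Z" "X \<inter> Y = {}"
    and inc: "\<And>x y. x \<in> X \<Longrightarrow> y \<in> Y \<Longrightarrow> (x, y) \<notin> r \<and> (y, x) \<notin> r"
  shows "width X r + width Y r \<le> width Z r"
proof -
  have fin: "finite X" "finite Y"
    using assms(1,2) by (auto intro: finite_subset)
  obtain A where A: "antichain_in X r A" "card A = width X r"
    using width_witness fin(1) by metis
  obtain B where B: "antichain_in Y r B" "card B = width Y r"
    using width_witness fin(2) by metis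
  have sub: "A \<subseteq> X" "B \<subseteq> Y"
    using A B by (auto simp: antichain_in_def)
  have "antichain_in Z r (A \<union> B)"
    using A(1) B(1) assms(2) inc unfolding antichain_in_def by blast
  then have "card (A \<union> B) \<le> width Z r"
    by (rule card_le_width[OF assms(1)])
  moreover have "card (A \<union> B) = card A + card B"
    using sub fin assms(3) by (intro card_Un_disjoint) (auto intro: finite_subset)
  ultimately show ?thesis
    using A(2) B(2) by simp
qed

lemma width_pos:
  assumes "finite X" "a \<in> X" "(a, a) \<notin> r"
  shows "0 < width X r"
proof -
  have "antichain_in X r {a}"
    using assms by (simp add: antichain_in_def)
  from card_le_width[OF assms(1) this] show ?thesis
    by simp
qed

text \<open>The singleton \<open>{a}\<close> has positive width and is incomparable to all of
  \<open>X\<close>, so adding the two widths gives a strict increase.\<close>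

lemma width_less:
  assumes "finite Z" "insert a X \<subseteq> Z" "a \<notin> X" "(a, a) \<notin> r"
    and "\<And>x. x \<in> X \<Longrightarrow> (x, a) \<notin> r \<and> (a, x) \<notin> r"
  shows "width X r < width Z r"
proof -
  have "width X r + width {a} r \<le> width Z r"
    using assms by (intro width_add_le) auto
  then show ?thesis
    using width_pos[of "{a}" a r] assms(4) by simp
qed

section \<open>Queues from edge colourings, and the number of colours\<close>

lemma queue_layout_of_colouring:
  assumes "total_order_of V \<sigma>" "finite C" "g ` E \<subseteq> C"
    and nest: "\<And>e f. e \<in> E \<Longrightarrow> f \<in> E \<Longrightarrow> nests \<sigma> e f \<Longrightarrow> g e \<noteq> g f"
  shows "\<exists>Q. queue_layout V E \<sigma> Q \<and> card Q \<le> card C"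
proof (intro exI conjI)
  \<comment> \<open>The queues are the colour classes of the colours that occur; ranging over all of
    \<open>C\<close> could produce empty blocks.\<close>
  let ?Q = "(\<lambda>c. {e \<in> E. g e = c}) ` g ` E"
  have fin: "finite (g ` E)"
    using assms(2,3) finite_subset by blast
  have "partition_on E ?Q"
    by (rule partition_onI) (auto simp: disjnt_def)
  moreover have "\<not> nests \<sigma> e f" if "q \<in> ?Q" "e \<in> q" "f \<in> q" for q e f
  proof -
    have "e \<in> E" "f \<in> E" "g e = g f"
      using that by auto
    then show ?thesis
      using nest by metis
  qed
  ultimately show "queue_layout V E \<sigma> ?Q"
    unfolding queue_layout_def using assms(1) fin by blast
  have "card ?Q \<le> card (g ` E)"
    using fin by (rule card_image_le)
  also have "\<dots> \<le> card C"
    using assms(2,3) by (rule card_mono)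
  finally show "card ?Q \<le> card C" .
qed

lemma card_triangle: "card (SIGMA s:{..<w}. {1..w - s}) = w * (w + 1) div 2"
proof -
  have "card (SIGMA s:{..<w}. {1..w - s}) = (\<Sum>s<w. w - s)"
    by simp
  also have "\<dots> = (\<Sum>s<w. Suc s)"
    by (rule sum.reindex_bij_witness[of _ "\<lambda>s. w - Suc s" "\<lambda>s. w - Suc s"]) auto
  also have "\<dots> = w * (w + 1) div 2"
    by (induction w) auto
  finally show ?thesis .
qed

section \<open>The two sides of a cover relation and its colour\<close>

definition lower_side :: "'a rel \<Rightarrow> 'a rel \<Rightarrow> 'a set \<Rightarrow> 'a \<Rightarrow> 'a set" where
  "lower_side L1 L2 X a = {z \<in> X. (z, a) \<in> L1\<^sup>= \<and> (a, z) \<in> L2\<^sup>=}"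

text \<open>Unlike the lower side, which contains \<open>a\<close>, this set may be empty: for
  \<open>a < b\<close> it omits \<open>b\<close>, which comes after \<open>a\<close> in
  \<open>L2\<close>. Hence the first colour component starts at 0 and the second at 1.\<close>

definition upper_side :: "'a rel \<Rightarrow> 'a rel \<Rightarrow> 'a set \<Rightarrow> 'a \<Rightarrow> 'a \<Rightarrow> 'a set" where
  "upper_side L1 L2 X a b = {z \<in> X. (b, z) \<in> L1\<^sup>= \<and> (z, a) \<in> L2}"

definition cover_colour :: "'a rel \<Rightarrow> 'a rel \<Rightarrow> 'a rel \<Rightarrow> 'a set \<Rightarrow> 'a \<Rightarrow> 'a \<Rightarrow> nat \<times> nat" where
  "cover_colour r L1 L2 X a b =
     (width (upper_side L1 L2 X a b) r, width (lower_side L1 L2 X a) r)"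

context
  fixes X :: "'a set" and r L1 L2 :: "'a rel"
  assumes poset: "finite_poset X r"
    and two_dim: "two_dimensional_realizers X r L1 L2"
begin

lemma orders: "total_order_of X L1" "total_order_of X L2"
  using two_dim by (auto simp: two_dimensional_realizers_def linear_extension_def)

lemma realizer_iff: "(a, b) \<in> r \<longleftrightarrow> (a, b) \<in> L1 \<and> (a, b) \<in> L2"
  using two_dim total_order_of_subset[OF orders(1)]
  unfolding two_dimensional_realizers_def linear_extension_def by blast

lemmas L1_trans = total_order_of_trans[OF orders(1)]
  and L2_trans = total_order_of_trans[OF orders(2)]
  and L1_irrefl = total_order_of_irrefl[OF orders(1)]
  and L2_irrefl = total_order_of_irrefl[OF orders(2)]
  and L2_total = total_order_of_total[OF orders(2)]
  and L1_subset = total_order_of_subset[OF orders(1)]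

lemma incomparable: "(a, b) \<in> L1 \<Longrightarrow> (b, a) \<in> L2 \<Longrightarrow> (a, b) \<notin> r \<and> (b, a) \<notin> r"
  using realizer_iff total_order_of_asym orders by metis

lemma finite_sides: "finite X" "finite (lower_side L1 L2 X a)" "finite (upper_side L1 L2 X a b)"
  using poset by (auto simp: finite_poset_def lower_side_def upper_side_def)

lemma cover_colour_bound:
  assumes "covers r a b"
  shows "cover_colour r L1 L2 X a b \<in> (SIGMA s:{..<width X r}. {1..width X r - s})"
proof -
  let ?U = "upper_side L1 L2 X a b" and ?D = "lower_side L1 L2 X a"
  have ab: "(a, b) \<in> L1"
    using assms realizer_iff by (auto simp: covers_def)
  \<comment> \<open>The chains are \<open>y \<le> a < b \<le> x\<close> in \<open>L1\<close> and
    \<open>x < a \<le> y\<close> in \<open>L2\<close>.\<close>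
  have opp: "(y, x) \<in> L1 \<and> (x, y) \<in> L2" if "x \<in> ?U" "y \<in> ?D" for x y
    using that ab unfolding upper_side_def lower_side_def
    by (auto intro: L1_trans L2_trans)
  have "width ?U r + width ?D r \<le> width X r"
  proof (rule width_add_le)
    show "?U \<inter> ?D = {}"
      using opp L1_irrefl by blast
    show "(x, y) \<notin> r \<and> (y, x) \<notin> r" if "x \<in> ?U" "y \<in> ?D" for x y
      using opp[OF that] incomparable by blast
  qed (auto simp: finite_sides upper_side_def lower_side_def)
  \<comment> \<open>Together with the bound on the sum, this also keeps the first component below
    \<open>width X r\<close>.\<close>
  moreover have "0 < width ?D r"
  proof (rule width_pos)
    show "a \<in> ?D"
      using L1_subset[OF ab] by (simp add: lower_side_def)
    show "(a, a) \<notin> r"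
      using realizer_iff L1_irrefl by blast
  qed (rule finite_sides)
  ultimately show ?thesis
    by (auto simp: cover_colour_def)
qed

lemma cover_colour_nested:
  assumes uv: "covers r u v" and ab: "covers r a b"
    and L: "(u, a) \<in> L1" "(a, b) \<in> L1" "(b, v) \<in> L1"
  shows "cover_colour r L1 L2 X u v \<noteq> cover_colour r L1 L2 X a b"
proof (cases "(a, u) \<in> L2")
  case True
  have "width (lower_side L1 L2 X u) r < width (lower_side L1 L2 X a) r"
  proof (rule width_less)
    \<comment> \<open>Here \<open>x \<le> u < a\<close> in \<open>L1\<close> and
      \<open>a < u \<le> x\<close> in \<open>L2\<close>; strictness shows that \<open>a\<close> is
      new.\<close>
    have opp: "(x, a) \<in> L1 \<and> (a, x) \<in> L2" if "x \<in> lower_side L1 L2 X u" for x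
      using that True L(1) by (auto simp: lower_side_def intro: L1_trans L2_trans)
    show "a \<notin> lower_side L1 L2 X u"
      using opp L1_irrefl by blast
    show "insert a (lower_side L1 L2 X u) \<subseteq> lower_side L1 L2 X a"
      using opp L1_subset[OF L(1)] by (auto simp: lower_side_def)
    show "(x, a) \<notin> r \<and> (a, x) \<notin> r" if "x \<in> lower_side L1 L2 X u" for x
      using opp[OF that] incomparable by blast
    show "(a, a) \<notin> r"
      using realizer_iff L1_irrefl by blast
  qed (rule finite_sides)
  then show ?thesis
    by (simp add: cover_colour_def)
next
  case False
  have "u \<in> X" "a \<in> X" "v \<in> X" "u \<noteq> a"
    using L L1_subset L1_irrefl by blast+
  have "(u, a) \<in> r"
    using False L2_total[OF \<open>u \<in> X\<close> \<open>a \<in> X\<close> \<open>u \<noteq> a\<close>] realizer_iff L(1) by blast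
  then have "(a, v) \<notin> r"
    using uv by (auto simp: covers_def)
  moreover have av: "(a, v) \<in> L1"
    using L L1_trans by blast
  ultimately have va: "(v, a) \<in> L2"
    using L2_total[OF \<open>a \<in> X\<close> \<open>v \<in> X\<close>] realizer_iff L1_irrefl by blast
  have uv2: "(u, v) \<in> L2"
    using uv realizer_iff by (auto simp: covers_def)
  have "width (upper_side L1 L2 X u v) r < width (upper_side L1 L2 X a b) r"
  proof (rule width_less)
    \<comment> \<open>In \<open>L2\<close>, \<open>x < u < v\<close>. So
      \<open>x \<noteq> v\<close>, and \<open>v \<le> x\<close> in \<open>L1\<close> becomes
      strict.\<close>
    have opp: "(v, x) \<in> L1 \<and> (x, v) \<in> L2" if "x \<in> upper_side L1 L2 X u v" for x
    proof -
      have "(x, v) \<in> L2"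
        using that uv2 by (auto simp: upper_side_def intro: L2_trans)
      with that show ?thesis
        using L2_irrefl by (auto simp: upper_side_def)
    qed
    show "v \<notin> upper_side L1 L2 X u v"
      using opp L1_irrefl by blast
    \<comment> \<open>An old element \<open>x\<close> satisfies \<open>b < v < x\<close> in
      \<open>L1\<close> and \<open>x < v < a\<close> in \<open>L2\<close>.\<close>
    show "insert v (upper_side L1 L2 X u v) \<subseteq> upper_side L1 L2 X a b"
      using opp va L(3) \<open>v \<in> X\<close> by (auto simp: upper_side_def intro: L1_trans L2_trans)
    show "(x, v) \<notin> r \<and> (v, x) \<notin> r" if "x \<in> upper_side L1 L2 X u v" for x
      using opp[OF that] incomparable by blast
    show "(v, v) \<notin> r"
      using realizer_iff L1_irrefl by blast
  qed (rule finite_sides)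
  then show ?thesis
    by (simp add: cover_colour_def)
qed

section \<open>From cover relations to unordered edges\<close>

lemma covers_of_edge:
  assumes "{a, b} \<in> cover_graph_edges r" "(a, b) \<in> L1"
  shows "covers r a b"
proof -
  obtain c d where cd: "{a, b} = {c, d}" "covers r c d"
    using assms(1) by (auto simp: cover_graph_edges_def)
  then have "(c, d) \<in> L1"
    using realizer_iff by (simp add: covers_def)
  \<comment> \<open>Both \<open>(a, b)\<close> and \<open>(c, d)\<close> point upwards in
    \<open>L1\<close>, so asymmetry rules out the swapped matching of the endpoints.\<close>
  then show ?thesis
    using cd assms(2) total_order_of_asym[OF orders(1)] by (metis doubleton_eq_iff)
qed

lemma cover_graph_queue_layout:
  "\<exists>Q. queue_layout X (cover_graph_edges r) L1 Q \<and> card Q \<le> width X r * (width X r + 1) div 2"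
proof -
  \<comment> \<open>Colours belong to oriented pairs. An edge has exactly one orientation that is a
    cover relation, so the description is unique on edges; its value elsewhere is arbitrary.\<close>
  define g where "g e = (THE c. \<exists>a b. e = {a, b} \<and> covers r a b \<and> c = cover_colour r L1 L2 X a b)"
    for e
  have g: "g {a, b} = cover_colour r L1 L2 X a b" if "covers r a b" for a b
  proof -
    have uniq: "a' = a \<and> b' = b" if "{a, b} = {a', b'}" "covers r a' b'" for a' b'
    proof -
      have "(a, b) \<in> L1" "(a', b') \<in> L1"
        using \<open>covers r a b\<close> that(2) realizer_iff by (simp_all add: covers_def)
      then show ?thesis
        using that(1) total_order_of_asym[OF orders(1)] by (metis doubleton_eq_iff)
    qed
    show ?thesis
      unfolding g_def
    proof (rule the_equality)
      show "\<exists>a' b'. {a, b} = {a', b'} \<and> covers r a' b' \<and>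
          cover_colour r L1 L2 X a b = cover_colour r L1 L2 X a' b'"
        using that by blast
      show "c = cover_colour r L1 L2 X a b"
        if "\<exists>a' b'. {a, b} = {a', b'} \<and> covers r a' b' \<and> c = cover_colour r L1 L2 X a' b'" for c
        using that uniq by metis
    qed
  qed
  have "\<exists>Q. queue_layout X (cover_graph_edges r) L1 Q \<and>
      card Q \<le> card (SIGMA s:{..<width X r}. {1..width X r - s})"
  proof (rule queue_layout_of_colouring[OF orders(1)])
    show "g ` cover_graph_edges r \<subseteq> (SIGMA s:{..<width X r}. {1..width X r - s})"
      using g cover_colour_bound by (fastforce simp: cover_graph_edges_def)
    show "g e \<noteq> g f"
      if e: "e \<in> cover_graph_edges r" and f: "f \<in> cover_graph_edges r" and "nests L1 e f" for e f
    proof -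
      obtain u v a b where ef: "e = {u, v}" "f = {a, b}"
        and L: "(u, a) \<in> L1" "(a, b) \<in> L1" "(b, v) \<in> L1"
        using \<open>nests L1 e f\<close> by (auto simp: nests_def)
      \<comment> \<open>Nesting alone does not orient the edges as covers; the direction of
        \<open>L1\<close> does.\<close>
      have "(u, v) \<in> L1"
        using L L1_trans by blast
      then have "covers r u v" "covers r a b"
        using covers_of_edge e f ef L(2) by auto
      then show ?thesis
        using cover_colour_nested L g ef by simp
    qed
  qed simp
  then show ?thesis
    by (simp only: card_triangle)
qed

end

theorem theorem2:
  fixes X :: "'a set" and r L1 L2 :: "'a rel" and w :: nat
  assumes "finite_poset X r"
    and "width X r = w"
    and "two_dimensional_realizers X r L1 L2"
  shows "\<exists>\<sigma>\<in>{L1, L2}. \<exists>Q. queue_layout X (cover_graph_edges r) \<sigma> Q \<and> card Q \<le> w * (w + 1) div 2"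
  \<comment> \<open>The vertex order chosen is \<open>L1\<close>.\<close>
  using cover_graph_queue_layout[OF assms(1,3)] assms(2) by blast

end
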